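(* Let $k\ge2$ be an integer and let $t_k$ be the largest odd number less than $k$. Let $$G_k^{(1)}(\tau):=\big(g_{1,k}(\tau),g_{3,k}(\tau),\dots,g_{t_k,k}(\tau)\big)^{\mathrm T}.$$ Then for all $\tau$ with $\mathrm{Im}\,\tau>0$, $$G_k^{(1)}(\tau+1)=\Lambda_k G_k^{(1)}(\tau),\qquad G_k^{(1)}\Big(-\frac{1}{4\tau}\Big)=\frac{2(-2i\tau)^{1/2}}{\sqrt k}\,A_k\,G_k^{(1)}(\tau),$$ where $A_k=(a_{ij})$ is the $\lfloor k/2\rfloor\times\lfloor k/2\rfloor$ matrix with entries $a_{ij}=\cos\frac{(2i-1)(2j-1)\pi}{2k}$ and $$\Lambda_k:=\mathrm{diag}\big(e^{\frac{1}{2k}\pi i},e^{\frac{9}{2k}\pi i},\dots,e^{\frac{t_k^2}{2k}\pi i}\big).$$ As a consequence, $$G_k^{(1)}\Big(\frac{\tau}{4\tau+1}\Big)=\frac{4\sqrt{4\tau+1}}{k}\,A_k\Lambda_k^{-1}A_k\,G_k^{(1)}(\tau).$$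
   Context: For integers $m\ge1$ and $j$, and $\mathrm{Im}\,\tau>0$, $q=e^{2\pi i\tau}$ (with $q^r:=e^{2\pi i r\tau}$ for rational $r$), define the theta series $g_{j,m}(\tau):=\sum_{n\in\mathbb Z}(-1)^n q^{m(n+\frac{j}{2m})^2}$. Square roots denote the principal branch. *)

theory Defs
  imports "HOL-Analysis.Analysis" "Jordan_Normal_Form.Gauss_Jordan_Elimination"
begin

text \<open>The power \<open>q\<^sup>r = e\<^bsup>2\<pi>ir\<tau>\<^esup>\<close> depends on \<open>\<tau>\<close> and not only on \<open>q\<close>, so \<open>\<tau>\<close> is the argument.\<close>

definition qpow :: "complex \<Rightarrow> real \<Rightarrow> complex" where
  "qpow \<tau> r = exp (2 * complex_of_real pi * \<i> * complex_of_real r * \<tau>)"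

text \<open>For \<open>m \<ge> 1\<close> and \<open>Im \<tau> > 0\<close> the series converges absolutely; elsewhere the value is
  unspecified by the mathematics and irrelevant.\<close>

definition theta_g :: "int \<Rightarrow> nat \<Rightarrow> complex \<Rightarrow> complex" where
  "theta_g j m \<tau> =
     (\<Sum>\<^sub>\<infinity>n::int. (- 1) powi n * qpow \<tau> (real m * (real_of_int n + real_of_int j / (2 * real m))\<^sup>2))"

definition t_max :: "nat \<Rightarrow> nat" where
  "t_max k = Max {t. odd t \<and> t < k}"

text \<open>Vectors and matrices are indexed from 0, so the \<open>i\<close>-th entry belongs to the odd number
  \<open>2i + 1\<close>. The odd numbers \<open>1, 3, \<dots>, t\<close> are \<open>(t + 1) / 2\<close> in number.\<close>

definition G1 :: "nat \<Rightarrow> complex \<Rightarrow> complex Matrix.vec" where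
  "G1 k \<tau> = Matrix.vec ((t_max k + 1) div 2) (\<lambda>i. theta_g (2 * int i + 1) k \<tau>)"

definition Lambda_mat :: "nat \<Rightarrow> complex Matrix.mat" where
  "Lambda_mat k = mat_diag ((t_max k + 1) div 2)
     (\<lambda>i. exp (of_nat ((2 * i + 1)\<^sup>2) / (2 * of_nat k) * complex_of_real pi * \<i>))"

text \<open>With 1-based indices the entry is \<open>cos ((2i - 1)(2j - 1)\<pi> / (2k))\<close>.\<close>

definition A_mat :: "nat \<Rightarrow> complex Matrix.mat" where
  "A_mat k = Matrix.mat (k div 2) (k div 2)
     (\<lambda>(i, j). complex_of_real (cos (real (2 * i + 1) * real (2 * j + 1) * pi / (2 * real k))))"

text \<open>\<open>mat_inverse\<close> returns \<open>Some\<close> inverse exactly for invertible square matrices.\<close>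

definition mat_inv :: "complex Matrix.mat \<Rightarrow> complex Matrix.mat" where
  "mat_inv M = the (mat_inverse M)"

end

(* Poisson summation applied to a Gaussian times the character exp(-pi i x) turns g_{j,m}(-1/(4 tau)),
   for tau on the imaginary axis, into a series over odd integers s of exp(pi i s j / (2m)) q^{s^2/(4m)};
   the identity theorem extends this to the upper half plane. Splitting s by its residue modulo 2m gives a
   combination of the g_{r,m} with r odd, and g_{2m-r,m} = - g_{r,m} folds it to r < m, leaving the cosines.
   The last formula follows by writing tau/(4 tau + 1) = -1/(4 sigma) with sigma + 1 = -1/(4 tau). *)
theory Submission
  imports Defs "HOL-Probability.Characteristic_Functions" "HOL-Complex_Analysis.Conformal_Mappings"
begin

section \<open>Uniqueness of Fourier coefficients\<close>

text \<open>Poisson summation rests on a uniqueness argument: the sum of the integer translates of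
  \<phi> and the Fourier series with coefficients \<open>c\<close> are continuous and 1-periodic
  with the same coefficients, and Stone-Weierstrass on the unit circle shows that such functions
  coincide. The character exp(-pi i x) equals (-1)^n at x = n and moves the frequencies by one half,
  which is why odd integers s appear. On the imaginary axis the powers of q are real Gaussians and
  the principal root is an ordinary one, so the Fourier transform of a Gaussian, read off from the
  characteristic function of the normal distribution, suffices. For odd j the shift of s by 2m
  multiplies exp(pi i s j / (2m)) by -1, which reproduces the sign (-1)^n of the theta series. The
  branch of the root in the last formula is settled because -2i tau and -2i sigma both lie in the
  right half plane.\<close>

inductive trig_poly :: "(real \<Rightarrow> complex) \<Rightarrow> bool" where
  cis: "trig_poly (\<lambda>x. c * cis (2 * pi * of_int l * x))"
| add: "trig_poly f \<Longrightarrow> trig_poly g \<Longrightarrow> trig_poly (\<lambda>x. f x + g x)"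

lemma trig_poly_const: "trig_poly (\<lambda>x. c)"
  using trig_poly.cis[of c 0] by simp

lemma trig_poly_mult_cis:
  assumes "trig_poly f"
  shows "trig_poly (\<lambda>x. f x * (c * cis (2 * pi * of_int l * x)))"
  using assms
proof induction
  case (cis d m)
  have "(\<lambda>x. d * cis (2 * pi * of_int m * x) * (c * cis (2 * pi * of_int l * x)))
      = (\<lambda>x. (d * c) * cis (2 * pi * of_int (m + l) * x))"
    by (rule ext) (simp add: algebra_simps cis_mult[symmetric])
  then show ?case by (simp only: trig_poly.cis)
next
  case (add f g)
  then show ?case by (auto simp: distrib_right intro: trig_poly.add)
qed

lemma trig_poly_mult:
  assumes "trig_poly g" "trig_poly f"
  shows "trig_poly (\<lambda>x. f x * g x)"
  using assms by induction (auto simp: distrib_left intro: trig_poly.add trig_poly_mult_cis)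

lemma trig_poly_cos: "trig_poly (\<lambda>x. complex_of_real (cos (2 * pi * x)))"
proof -
  have "(\<lambda>x. complex_of_real (cos (2 * pi * x)))
      = (\<lambda>x. (1 / 2) * cis (2 * pi * of_int 1 * x) + (1 / 2) * cis (2 * pi * of_int (-1) * x))"
    by (rule ext) (simp add: complex_eq_iff)
  then show ?thesis by (simp only: trig_poly.intros)
qed

lemma trig_poly_sin: "trig_poly (\<lambda>x. complex_of_real (sin (2 * pi * x)))"
proof -
  have "(\<lambda>x. complex_of_real (sin (2 * pi * x)))
      = (\<lambda>x. (- \<i> / 2) * cis (2 * pi * of_int 1 * x) + (\<i> / 2) * cis (2 * pi * of_int (-1) * x))"
    by (rule ext) (simp add: complex_eq_iff)
  then show ?thesis by (simp only: trig_poly.intros)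
qed

text \<open>A real-linear functional on the plane is a combination of \<open>Re\<close> and
  \<open>Im\<close>, which on the circle are cos and sin of 2 pi x; sums and products stay among the
  trigonometric polynomials. This links the polynomials of Stone-Weierstrass to the
  characters.\<close>

lemma trig_poly_real_polynomial:
  fixes p :: "complex \<Rightarrow> real"
  assumes "real_polynomial_function p"
  shows "trig_poly (\<lambda>x. complex_of_real (p (cis (2 * pi * x))))"
  using assms
proof induction
  case (linear f)
  interpret f: bounded_linear f by fact
  have f: "f z = Re z * f 1 + Im z * f \<i>" for z
  proof -
    have "z = Re z *\<^sub>R 1 + Im z *\<^sub>R \<i>" by (simp add: complex_eq_iff)
    then have "f z = f (Re z *\<^sub>R 1 + Im z *\<^sub>R \<i>)" by simp
    then show ?thesis by (simp add: f.add f.scaleR)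
  qed
  have "(\<lambda>x. complex_of_real (f (cis (2 * pi * x)))) =
     (\<lambda>x. complex_of_real (cos (2 * pi * x)) * complex_of_real (f 1)
        + complex_of_real (sin (2 * pi * x)) * complex_of_real (f \<i>))"
    by (subst f) simp
  then show ?case
    by (simp only:) (intro trig_poly.add trig_poly_mult trig_poly_const trig_poly_cos trig_poly_sin)
next
  case (const c)
  show ?case by (rule trig_poly_const)
next
  case (add f g)
  then show ?case using trig_poly.add[OF add.IH] by simp
next
  case (mult f g)
  then show ?case using trig_poly_mult[OF mult.IH(2,1)] by simp
qed

lemma trig_poly_polynomial:
  fixes p :: "complex \<Rightarrow> complex"
  assumes "polynomial_function p"
  shows "trig_poly (\<lambda>x. p (cis (2 * pi * x)))"
proof -
  have "real_polynomial_function (Re \<circ> p)" "real_polynomial_function (Im \<circ> p)"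
    using assms by (auto simp: polynomial_function_def bounded_linear_Re bounded_linear_Im)
  note * = this[THEN trig_poly_real_polynomial, unfolded o_def]
  have "(\<lambda>x. p (cis (2 * pi * x))) = (\<lambda>x. complex_of_real (Re (p (cis (2 * pi * x))))
     + complex_of_real (Im (p (cis (2 * pi * x)))) * \<i>)"
    by (rule ext) (simp add: complex_eq_iff)
  then show ?thesis
    by (simp only:) (intro trig_poly.add trig_poly_mult trig_poly_const *)
qed

lemma continuous_on_trig_poly: "trig_poly f \<Longrightarrow> continuous_on A f"
  by (induction rule: trig_poly.induct) (auto intro!: continuous_intros)

section \<open>Periodic functions as functions on the circle\<close>

lemma Arg2pi_conv_Arg: "Arg2pi z = (if 0 \<le> Arg z \<or> z = 0 then Arg z else Arg z + 2 * pi)"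
proof (cases "z = 0")
  case False
  define t where "t = (if 0 \<le> Arg z then Arg z else Arg z + 2 * pi)"
  have "exp (\<i> * complex_of_real t) = exp (\<i> * complex_of_real (Arg z))"
    by (simp add: t_def algebra_simps exp_add exp_two_pi_i)
  then have "z = of_real (norm z) * exp (\<i> * complex_of_real t)" using Arg_eq[OF False] by simp
  moreover have "0 \<le> t" "t < 2 * pi"
    using Arg_bounded[of z] by (auto simp: t_def)
  ultimately have "Arg2pi z = t"
    using False by (intro Arg2pi_unique[of "norm z"]) auto
  with False show ?thesis by (simp add: t_def)
qed (simp add: Arg_zero)

text \<open>\<open>Arg2pi\<close> jumps across the positive real axis and \<open>Arg\<close> across
  the negative one. By periodicity both give the same value of \<open>H\<close>, so near each point
  of the circle the branch that is continuous there can be used. The domain includes negative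
  numbers because \<open>Arg z / (2 * pi)\<close> ranges between -1/2 and 1/2.\<close>

lemma continuous_on_circle:
  fixes H :: "real \<Rightarrow> 'a::t2_space"
  assumes cont: "continuous_on {-1..1} H" and per: "\<And>x. x \<in> {-1..0} \<Longrightarrow> H (x + 1) = H x"
  shows "continuous_on (sphere 0 1) (\<lambda>z. H (Arg2pi z / (2 * pi)))"
proof -
  have eq: "H (Arg2pi z / (2 * pi)) = H (Arg z / (2 * pi))" for z
  proof (cases "0 \<le> Arg z \<or> z = 0")
    case False
    then have "Arg2pi z / (2 * pi) = Arg z / (2 * pi) + 1"
      by (simp add: Arg2pi_conv_Arg field_simps)
    then show ?thesis
      using per[of "Arg z / (2 * pi)"] Arg_bounded[of z] False by (simp add: field_simps)
  qed (simp add: Arg2pi_conv_Arg)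
  have cont': "isCont H x" if "x \<in> {-1<..<1}" for x
    using continuous_on_interior[OF cont, of x] that by simp
  show ?thesis
  proof (intro continuous_at_imp_continuous_on ballI)
    fix z :: complex assume z: "z \<in> sphere 0 1"
    show "isCont (\<lambda>z. H (Arg2pi z / (2 * pi))) z"
    proof (cases "z \<in> \<real>\<^sub>\<ge>\<^sub>0")
      case False
      have "isCont (\<lambda>z. Arg2pi z / (2 * pi)) z"
        using False by (intro continuous_intros continuous_at_Arg2pi) auto
      moreover have "isCont H (Arg2pi z / (2 * pi))"
        using Arg2pi[of z] by (intro cont') (auto simp: field_simps)
      ultimately show ?thesis by (rule isCont_o2)
    next
      case True
      have *: "z \<notin> \<real>\<^sub>\<le>\<^sub>0"
        using True z by (auto simp: complex_nonneg_Reals_iff complex_nonpos_Reals_iff complex_eq_iff cmod_def)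
      then have "isCont (\<lambda>z. Arg z / (2 * pi)) z"
        by (intro continuous_intros continuous_at_Arg) auto
      moreover have "Arg z \<noteq> pi" using * Arg_eq_pi by (auto simp: complex_nonpos_Reals_iff)
      then have "isCont H (Arg z / (2 * pi))"
        using Arg_bounded[of z] by (intro cont') (auto simp: field_simps)
      ultimately show ?thesis unfolding eq by (rule isCont_o2)
    qed
  qed
qed

text \<open>If a trigonometric polynomial \<open>P\<close> is within \<open>e\<close> of the
  conjugate of \<open>H\<close> on the circle, orthogonality turns the integral of |H|^2 into that
  of H (cnj H - P), which is at most \<open>e\<close> times the integral of |H|. Letting
  \<open>e\<close> tend to 0 leaves a continuous nonnegative function with integral 0.\<close>

lemma fourier_unique:
  fixes H :: "real \<Rightarrow> complex"
  assumes cont: "continuous_on {-1..1} H" and per: "\<And>x. x \<in> {-1..0} \<Longrightarrow> H (x + 1) = H x"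
    and zero: "\<And>l::int. integral {0..1} (\<lambda>x. H x * cis (2 * pi * of_int l * x)) = 0"
    and x: "x \<in> {0..1}"
  shows "H x = 0"
proof -
  have cont0: "continuous_on {0..1} H" by (rule continuous_on_subset[OF cont]) auto
  have trig: "integral {0..1} (\<lambda>x. H x * f x) = 0" if "trig_poly f" for f
    using that
  proof induction
    case (cis c l)
    have "(\<lambda>x. H x * (c * cis (2 * pi * of_int l * x))) = (\<lambda>x. c * (H x * cis (2 * pi * of_int l * x)))"
      by (simp add: mult_ac)
    then show ?case using zero[of l] by simp
  next
    case (add f g)
    have "(\<lambda>x. H x * f x) integrable_on {0..1}" "(\<lambda>x. H x * g x) integrable_on {0..1}"
      by (intro integrable_continuous_interval continuous_intros cont0 continuous_on_trig_poly add)+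
    then show ?case using add by (simp add: distrib_left integral_add)
  qed
  define J where "J = integral {0..1} (\<lambda>x. (norm (H x))\<^sup>2)"
  define K where "K = integral {0..1} (\<lambda>x. norm (H x))"
  have J_le: "J \<le> e * K" if "e > 0" for e
  proof -
    define f where "f z = cnj (H (Arg2pi z / (2 * pi)))" for z
    have "continuous_on (sphere 0 1) f"
      unfolding f_def by (intro continuous_intros continuous_on_circle cont per)
    from Stone_Weierstrass_polynomial_function[OF compact_sphere this that]
    obtain p where p: "polynomial_function p" "\<And>z. z \<in> sphere 0 1 \<Longrightarrow> norm (f z - p z) < e" by blast
    define P where "P x = p (cis (2 * pi * x))" for x
    have P: "trig_poly P" unfolding P_def by (rule trig_poly_polynomial[OF p(1)])
    have fcis: "f (cis (2 * pi * x)) = cnj (H x)" if "x \<in> {0..1}" for x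
    \<comment> \<open>At \<open>x = 1\<close> the angle wraps around to 0, so \<open>f\<close> takes
      its value from \<open>H 0\<close>; periodicity gives \<open>H 1 = H 0\<close>.\<close>
    proof (cases "x = 1")
      case True
      then show ?thesis using per[of 0] by (simp add: f_def Arg2pi_of_real[of 1, simplified])
    next
      case False
      then have "Arg2pi (cis (2 * pi * x)) = 2 * pi * x"
        using that by (intro Arg2pi_unique[of 1]) (auto simp: cis_conv_exp)
      then show ?thesis by (simp add: f_def)
    qed
    have close: "norm (cnj (H x) - P x) \<le> e" if "x \<in> {0..1}" for x
      using p(2)[of "cis (2 * pi * x)"] fcis[OF that] by (simp add: P_def)
    note [continuous_intros] = cont0 continuous_on_trig_poly[OF P]
    have i: "(\<lambda>x. H x * P x) integrable_on {0..1}" "(\<lambda>x. H x * cnj (H x)) integrable_on {0..1}"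
      "(\<lambda>x. e * norm (H x)) integrable_on {0..1}" "(\<lambda>x. H x * (cnj (H x) - P x)) integrable_on {0..1}"
      "(\<lambda>x. (norm (H x))\<^sup>2) integrable_on {0..1}"
      by (auto intro!: integrable_continuous_interval continuous_intros)
    have "complex_of_real J = integral {0..1} (\<lambda>x. complex_of_real ((norm (H x))\<^sup>2))"
      unfolding J_def
      using integral_linear[OF i(5) bounded_linear_of_real[where 'a = complex]] by (simp add: o_def)
    also have "\<dots> = integral {0..1} (\<lambda>x. H x * cnj (H x))"
      by (simp only: complex_norm_square)
    also have "\<dots> = integral {0..1} (\<lambda>x. H x * (cnj (H x) - P x))"
      using trig[OF P] i by (simp add: right_diff_distrib integral_diff)
    finally have "J \<le> norm (integral {0..1} (\<lambda>x. H x * (cnj (H x) - P x)))"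
      by (metis abs_ge_self norm_of_real)
    also have "\<dots> \<le> integral {0..1} (\<lambda>x. e * norm (H x))"
      using close by (intro integral_norm_bound_integral i)
        (auto simp: norm_mult mult.commute[of e] intro!: mult_left_mono)
    finally show ?thesis by (simp add: K_def)
  qed
  have "K \<ge> 0" unfolding K_def
    by (intro integral_nonneg integrable_continuous_interval continuous_intros cont0) auto
  have "J \<le> 0"
  proof (rule field_le_epsilon)
    fix e :: real assume "e > 0"
    \<comment> \<open>Dividing by \<open>K + 1\<close> rather than \<open>K\<close> covers the case
      \<open>K = 0\<close>.\<close>
    then have "J \<le> e / (K + 1) * K" using \<open>K \<ge> 0\<close> by (intro J_le) auto
    also have "\<dots> \<le> e" using \<open>e > 0\<close> \<open>K \<ge> 0\<close> by (simp add: field_simps)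
    finally show "J \<le> 0 + e" by simp
  qed
  moreover have "J \<ge> 0" unfolding J_def
    by (intro integral_nonneg integrable_continuous_interval continuous_intros cont0) auto
  ultimately have "J = 0" by simp
  then have "\<forall>x\<in>{0..1}. (norm (H x))\<^sup>2 = 0"
    unfolding J_def
    by (subst (asm) integral_eq_0_iff) (auto intro!: continuous_intros cont0)
  with x show ?thesis by auto
qed

section \<open>Poisson summation\<close>

text \<open>The majorant \<open>M\<close> makes the finite partial sums converge uniformly along the
  filter of finite index sets; uniform limits preserve continuity and commute with integration over
  a compact interval.\<close>

lemma
  fixes f :: "int \<Rightarrow> real \<Rightarrow> complex"
  assumes cont: "\<And>n. continuous_on {a..b} (f n)"
    and bound: "\<And>n x. x \<in> {a..b} \<Longrightarrow> norm (f n x) \<le> M n" and M: "M summable_on UNIV"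
  shows continuous_on_infsum: "continuous_on {a..b} (\<lambda>x. \<Sum>\<^sub>\<infinity>n. f n x)"
    and has_sum_integral:
      "((\<lambda>n. integral {a..b} (f n)) has_sum integral {a..b} (\<lambda>x. \<Sum>\<^sub>\<infinity>n. f n x)) UNIV"
proof -
  have u: "uniform_limit {a..b} (\<lambda>X x. \<Sum>n\<in>X. f n x) (\<lambda>x. \<Sum>\<^sub>\<infinity>n. f n x) (finite_subsets_at_top UNIV)"
    using bound M by (intro Weierstrass_m_test_general) auto
  have cont': "continuous_on {a..b} (\<lambda>x. \<Sum>n\<in>X. f n x)" for X
    by (intro continuous_intros cont)
  show "continuous_on {a..b} (\<lambda>x. \<Sum>\<^sub>\<infinity>n. f n x)"
    by (rule uniform_limit_theorem[OF _ u]) (auto intro: always_eventually cont')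
  obtain I J where IJ: "\<And>X. ((\<lambda>x. \<Sum>n\<in>X. f n x) has_integral I X) {a..b}"
    "((\<lambda>x. \<Sum>\<^sub>\<infinity>n. f n x) has_integral J) {a..b}" "(I \<longlongrightarrow> J) (finite_subsets_at_top UNIV)"
    using uniform_limit_integral[OF u cont'] by auto
  have "sum (\<lambda>n. integral {a..b} (f n)) X = I X" if "finite X" for X
  proof -
    have "((\<lambda>x. \<Sum>n\<in>X. f n x) has_integral (\<Sum>n\<in>X. integral {a..b} (f n))) {a..b}"
      by (intro has_integral_sum that integrable_integral integrable_continuous_interval cont)
    then show ?thesis using IJ(1) has_integral_unique by blast
  qed
  then have "eventually (\<lambda>X. I X = sum (\<lambda>n. integral {a..b} (f n)) X) (finite_subsets_at_top UNIV)"
    by (intro eventually_finite_subsets_at_top_weakI) auto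
  with IJ(3) have "((\<lambda>n. integral {a..b} (f n)) has_sum J) UNIV"
    unfolding has_sum_def by (rule Lim_transform_eventually)
  with IJ(2) show "((\<lambda>n. integral {a..b} (f n)) has_sum integral {a..b} (\<lambda>x. \<Sum>\<^sub>\<infinity>n. f n x)) UNIV"
    using integral_unique by blast
qed

lemma integral_cis:
  "integral {0..1} (\<lambda>x. cis (2 * pi * of_int m * x)) = (if m = 0 then 1 else 0)"
proof (cases "m = 0")
  case False
  define F where "F x = cis (2 * pi * of_int m * x) / (2 * pi * of_int m * \<i>)" for x
  have "(F has_vector_derivative cis (2 * pi * of_int m * x)) (at x within {0..1})" for x
    unfolding F_def cis_conv_exp has_vector_derivative_complex_iff[symmetric]
    using False
    by (auto intro!: derivative_eq_intros has_vector_derivative_real_field simp: scaleR_conv_of_real)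
  then have "((\<lambda>x. cis (2 * pi * of_int m * x)) has_integral (F 1 - F 0)) {0..1}"
    by (intro fundamental_theorem_of_calculus) auto
  moreover have "cis (2 * pi * of_int m) = 1"
    using cis_multiple_2pi[of "of_int m"] by simp
  then have "F 1 - F 0 = 0" by (simp add: F_def)
  ultimately show ?thesis using False by (simp add: integral_unique)
qed simp

text \<open>The hypothesis \<open>hs\<close> is convergence along all finite sets of integers, so
  the sum may be computed along the symmetric ranges \<open>X N\<close>. There the unit intervals
  join up to \<open>[-N, N]\<close>, and dominated convergence gives the integral over the
  line.\<close>

lemma has_sum_integral_int:
  fixes g :: "real \<Rightarrow> complex"
  assumes g: "integrable lborel g"
    and hs: "((\<lambda>n. integral {0..1} (\<lambda>x. g (x + of_int n))) has_sum S) UNIV"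
  shows "S = (LINT x|lborel. g x)"
proof -
  \<comment> \<open>The interval belonging to \<open>n\<close> is \<open>[n, n + 1]\<close>, so the
    half-open range tiles exactly \<open>[-N, N]\<close>.\<close>
  define X where "X N = {- int N..<int N}" for N
  have X: "filterlim X (finite_subsets_at_top UNIV) sequentially"
    unfolding filterlim_finite_subsets_at_top
  proof (intro allI impI)
    fix A :: "int set" assume A: "finite A \<and> A \<subseteq> UNIV"
    then obtain B where B: "\<And>n. n \<in> A \<Longrightarrow> \<bar>n\<bar> \<le> B" using finite_abs_int_segment
      by (metis Max_ge finite_imageI image_eqI)
    show "\<forall>\<^sub>F N in sequentially. finite (X N) \<and> A \<subseteq> X N \<and> X N \<subseteq> UNIV"
      using eventually_gt_at_top[of "nat B"]
    proof eventually_elim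
      case (elim N)
      show ?case using B elim by (fastforce simp: X_def)
    qed
  qed
  have si: "set_integrable lborel {a..b} g" for a b :: real
    using g unfolding set_integrable_def by (intro integrable_mult_indicator) auto
  have gi: "g integrable_on {a..b}" for a b :: real
    by (rule set_borel_integral_eq_integral(1)[OF si])
  have "(\<Sum>n\<in>X N. integral {0..1} (\<lambda>x. g (x + of_int n))) = integral {- real N..real N} g" for N
  proof (induction N)
    case (Suc N)
    have *: "X (Suc N) = insert (- int N - 1) (insert (int N) (X N))" "- int N - 1 \<notin> insert (int N) (X N)"
      "int N \<notin> X N" "finite (X N)" by (auto simp: X_def)
    have "integral {0..1} (\<lambda>x. g (x + of_int n)) = integral {of_int n..of_int n + 1} g" for n
      using integral_shift_Icc_real[of 0 1 g "of_int n"] by (simp add: o_def add.commute)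
    then have "(\<Sum>n\<in>X (Suc N). integral {0..1} (\<lambda>x. g (x + of_int n)))
      = integral {- real N - 1..- real N} g + (integral {real N..real N + 1} g + integral {- real N..real N} g)"
      using * Suc by simp
    also have "integral {real N..real N + 1} g + integral {- real N..real N} g = integral {- real N..real N + 1} g"
      using Henstock_Kurzweil_Integration.integral_combine[of "- real N" "real N" "real N + 1" g] gi by (simp add: add.commute)
    also have "integral {- real N - 1..- real N} g + \<dots> = integral {- real N - 1..real N + 1} g"
      using Henstock_Kurzweil_Integration.integral_combine[of "- real N - 1" "- real N" "real N + 1" g] gi by simp
    finally have "(\<Sum>n\<in>X (Suc N). integral {0..1} (\<lambda>x. g (x + of_int n))) = integral {- real N - 1..real N + 1} g" .
    moreover have "- real N - 1 = - real (Suc N)" "real N + 1 = real (Suc N)" by simp_all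
    ultimately show ?case by (simp only:)
  qed (simp add: X_def)
  then have "(\<lambda>N. integral {- real N..real N} g) \<longlonglongrightarrow> S"
    using filterlim_compose[OF hs[unfolded has_sum_def] X] by simp
  moreover have "(\<lambda>N. integral {- real N..real N} g) = (\<lambda>N. LINT x|lborel. indicator {- real N..real N} x *\<^sub>R g x)"
    using set_borel_integral_eq_integral(2)[OF si] by (simp add: set_lebesgue_integral_def)
  moreover have "(\<lambda>N. LINT x|lborel. indicator {- real N..real N} x *\<^sub>R g x) \<longlonglongrightarrow> (LINT x|lborel. g x)"
  proof (rule integral_dominated_convergence[where w = "\<lambda>x. norm (g x)"])
    show "AE x in lborel. (\<lambda>N. indicator {- real N..real N} x *\<^sub>R g x) \<longlonglongrightarrow> g x"
    proof (rule AE_I2, rule tendsto_eventually)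
      fix x :: real
      obtain N0 where N0: "\<bar>x\<bar> \<le> real N0" using real_arch_simple by blast
      show "\<forall>\<^sub>F N in sequentially. indicator {- real N..real N} x *\<^sub>R g x = g x"
        using eventually_ge_at_top[of N0] by eventually_elim (use N0 in \<open>auto simp: indicator_def\<close>)
    qed
  qed (use g in \<open>auto simp: indicator_def\<close>)
  ultimately show ?thesis using LIMSEQ_unique by metis
qed

lemma cis_periodic: "cis (2 * pi * of_int l * (x + of_int n)) = cis (2 * pi * of_int l * x)"
proof -
  have "cis (2 * pi * of_int l * (x + of_int n)) = cis (2 * pi * of_int l * x) * cis (2 * pi * of_int (l * n))"
    by (simp add: cis_mult algebra_simps)
  then show ?thesis using cis_multiple_2pi[of "of_int (l * n)"] by simp
qed

text \<open>Both sides are values at 0: of the periodization \<open>F\<close> of \<phi> and of its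
  Fourier series \<open>S\<close>. The bounds \<open>M\<close> and the summability of
  \<open>c\<close> make the two series converge uniformly, so that \<open>fourier_unique\<close>
  applies to their difference.\<close>

theorem poisson_summation:
  fixes \<phi> :: "real \<Rightarrow> complex" and M :: "int \<Rightarrow> real"
  assumes cont: "continuous_on UNIV \<phi>" and int: "integrable lborel \<phi>"
    and bound: "\<And>n x. \<bar>x\<bar> \<le> 1 \<Longrightarrow> norm (\<phi> (x + of_int n)) \<le> M n" and M: "M summable_on UNIV"
    and c: "\<And>l::int. c l = (LINT x|lborel. \<phi> x * cis (- 2 * pi * of_int l * x))"
    and summable: "(\<lambda>l. norm (c l)) summable_on UNIV"
  shows "(\<Sum>\<^sub>\<infinity>n::int. \<phi> (of_int n)) = (\<Sum>\<^sub>\<infinity>l. c l)"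
proof -
  define F where "F x = (\<Sum>\<^sub>\<infinity>n::int. \<phi> (x + of_int n))" for x
  define S where "S x = (\<Sum>\<^sub>\<infinity>l::int. c l * cis (2 * pi * of_int l * x))" for x
  have cont': "continuous_on A (\<lambda>x. \<phi> (x + t))" for A t
    by (rule continuous_on_compose2[OF cont]) (auto intro!: continuous_intros)
  note ci = continuous_intros cont'
  have contF: "continuous_on {-1..1} F"
    unfolding F_def by (rule continuous_on_infsum[OF _ _ M]) (auto intro!: ci bound)
  have contS: "continuous_on {-1..1} S"
    unfolding S_def by (rule continuous_on_infsum[OF _ _ summable]) (auto intro!: ci simp: norm_mult)
  \<comment> \<open>The coefficients \<open>c\<close> use the conjugate character, so testing
    against frequency \<open>l\<close> yields the one at \<open>- l\<close>.\<close>
  have coeffF: "integral {0..1} (\<lambda>x. F x * cis (2 * pi * of_int l * x)) = c (- l)" for l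
  proof -
    define g where "g x = \<phi> x * cis (2 * pi * of_int l * x)" for x
    have "((\<lambda>n. integral {0..1} (\<lambda>x. \<phi> (x + of_int n) * cis (2 * pi * of_int l * x))) has_sum
        integral {0..1} (\<lambda>x. \<Sum>\<^sub>\<infinity>n. \<phi> (x + of_int n) * cis (2 * pi * of_int l * x))) UNIV"
      by (rule has_sum_integral[OF _ _ M]) (auto intro!: ci bound simp: norm_mult)
    \<comment> \<open>The character is 1-periodic and can be shifted along with \<phi>, which turns
      each term into an integral of a translate of \<open>g\<close>.\<close>
    then have hs: "((\<lambda>n. integral {0..1} (\<lambda>x. g (x + of_int n))) has_sum
        integral {0..1} (\<lambda>x. F x * cis (2 * pi * of_int l * x))) UNIV"
      by (simp add: g_def cis_periodic F_def infsum_cmult_left')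
    have "continuous_on UNIV g" unfolding g_def by (intro continuous_intros cont)
    then have "g \<in> borel_measurable lborel" by (simp add: borel_measurable_continuous_onI)
    then have "integrable lborel g"
      by (rule Bochner_Integration.integrable_bound[OF int]) (auto simp: g_def norm_mult)
    from has_sum_integral_int[OF this hs] show ?thesis by (simp add: c g_def)
  qed
  have coeffS: "integral {0..1} (\<lambda>x. S x * cis (2 * pi * of_int l * x)) = c (- l)" for l
  proof -
    have "((\<lambda>n. integral {0..1} (\<lambda>x. c n * cis (2 * pi * of_int n * x) * cis (2 * pi * of_int l * x))) has_sum
        integral {0..1} (\<lambda>x. \<Sum>\<^sub>\<infinity>n. c n * cis (2 * pi * of_int n * x) * cis (2 * pi * of_int l * x))) UNIV"
      by (rule has_sum_integral[OF _ _ summable]) (auto intro!: ci simp: norm_mult)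
    moreover have "integral {0..1} (\<lambda>x. c n * cis (2 * pi * of_int n * x) * cis (2 * pi * of_int l * x))
       = (if n = - l then c n else 0)" for n
    proof -
      have "(\<lambda>x. c n * cis (2 * pi * of_int n * x) * cis (2 * pi * of_int l * x))
        = (\<lambda>x. c n * cis (2 * pi * of_int (n + l) * x))"
        by (simp add: mult.assoc cis_mult algebra_simps)
      then show ?thesis using integral_cis[of "n + l"] by auto
    qed
    ultimately have "((\<lambda>n. if n = - l then c n else 0) has_sum
        integral {0..1} (\<lambda>x. S x * cis (2 * pi * of_int l * x))) UNIV"
      by (simp add: S_def infsum_cmult_left')
    moreover have "((\<lambda>n. if n = - l then c n else 0) has_sum c (- l)) UNIV"
      by (rule has_sum_finite_neutralI[of "{- l}"]) auto
    ultimately show ?thesis by (rule has_sum_unique)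
  qed
  have "F 0 - S 0 = 0"
  proof (rule fourier_unique[where H = "\<lambda>x. F x - S x"])
    show "continuous_on {-1..1} (\<lambda>x. F x - S x)" by (intro continuous_intros contF contS)
    fix x :: real
    have "F (x + 1) = F x" unfolding F_def
      by (rule infsum_reindex_bij_witness[of _ "\<lambda>n. n - 1" "\<lambda>n. n + 1"]) (auto simp: algebra_simps)
    moreover have "S (x + 1) = S x" using cis_periodic[where n = 1] by (simp add: S_def)
    ultimately show "F (x + 1) - S (x + 1) = F x - S x" by simp
  next
    fix l :: int
    have "continuous_on {0..1} F" "continuous_on {0..1} S"
      by (rule continuous_on_subset[OF contF] continuous_on_subset[OF contS]; simp)+
    then have "(\<lambda>x. F x * cis (2 * pi * of_int l * x)) integrable_on {0..1}"
        "(\<lambda>x. S x * cis (2 * pi * of_int l * x)) integrable_on {0..1}"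
      by (auto intro!: integrable_continuous_interval continuous_intros)
    then show "integral {0..1} (\<lambda>x. (F x - S x) * cis (2 * pi * of_int l * x)) = 0"
      using coeffF coeffS by (simp add: left_diff_distrib integral_diff)
  qed simp
  then show ?thesis by (simp add: F_def S_def)
qed

section \<open>Inversion of the real theta series\<close>

lemma summable_on_exp_neg_abs: "(\<lambda>n::int. exp (- \<bar>real_of_int n\<bar>)) summable_on UNIV"
proof -
  have "summable (\<lambda>n. exp (- 1 :: real) ^ n)" by (rule summable_geometric) simp
  then have "(\<lambda>n. exp (- 1 :: real) ^ n) summable_on UNIV"
    by (intro norm_summable_imp_summable_on) simp
  then have *: "(\<lambda>n. exp (- real n)) summable_on UNIV" by (simp add: exp_of_nat_mult[symmetric])
  have "(\<lambda>n::int. exp (- \<bar>real_of_int n\<bar>)) summable_on (range int \<union> range (\<lambda>n. - int n))"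
    by (intro summable_on_union; subst summable_on_reindex) (auto simp: o_def inj_def *)
  moreover have "range int \<union> range (\<lambda>n. - int n) = UNIV"
    by (auto intro: int_cases2)
  ultimately show ?thesis by simp
qed

text \<open>Completing the square, c (y - 1/(2c))^2 \<ge> 0 gives c y^2 \<ge> y - 1/(4c) for y = |n
  + x|, and y \<ge> |n| - B. The bound is uniform in \<open>x\<close>, as the majorant in Poisson
  summation requires.\<close>

lemma gaussian_le_exp_neg_abs:
  fixes c x B :: real and n :: int
  assumes "c > 0" "\<bar>x\<bar> \<le> B"
  shows "exp (- c * (of_int n + x)\<^sup>2) \<le> exp (1 / (4 * c) + B) * exp (- \<bar>of_int n\<bar>)"
proof -
  define y where "y = \<bar>of_int n + x\<bar>"
  have "0 \<le> c * (y - 1 / (2 * c))\<^sup>2" using assms by simp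
  also have "\<dots> = c * y\<^sup>2 - y + 1 / (4 * c)" using assms by (simp add: field_simps power2_eq_square)
  finally have "- c * (of_int n + x)\<^sup>2 \<le> 1 / (4 * c) - y" by (simp add: y_def)
  moreover have "\<bar>of_int n\<bar> - B \<le> y" using assms by (simp add: y_def)
  ultimately show ?thesis by (simp flip: exp_add)
qed

lemma summable_on_gaussian:
  fixes c x :: real
  assumes "c > 0"
  shows "(\<lambda>n::int. exp (- c * (of_int n + x)\<^sup>2)) summable_on UNIV"
  by (rule summable_on_comparison_test[OF summable_on_cmult_right[OF summable_on_exp_neg_abs]])
    (use gaussian_le_exp_neg_abs[OF assms order_refl] in auto)

text \<open>Up to a factor this is the normal density with mean \<open>- a\<close> and variance
  \<open>1 / (2 * pi * t)\<close>.\<close>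

lemma integrable_gaussian:
  fixes t a :: real
  assumes "t > 0"
  shows "integrable lborel (\<lambda>x. exp (- pi * t * (x + a)\<^sup>2))"
proof -
  have "(\<lambda>x. exp (- pi * t * (x + a)\<^sup>2)) =
      (\<lambda>x. sqrt (1 / t) * normal_density (- a) (sqrt (1 / (2 * pi * t))) x)"
    using assms by (rule_tac ext) (simp add: normal_density_def field_simps real_sqrt_divide)
  then show ?thesis using assms by (simp add: integrable_normal_density)
qed

text \<open>The characteristic function of the standard normal distribution at u is exp(-u^2/2). The
  substitution y = s (x + a) with s^2 = 2 pi t turns exp(-y^2/2) into the Gaussian here, and u = 2
  pi b / s turns the phase u y into 2 pi b (x + a), whose constant part becomes the
  prefactor.\<close>

lemma fourier_gaussian:
  fixes t a b :: real
  assumes "t > 0"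
  shows "(LINT x|lborel. complex_of_real (exp (- pi * t * (x + a)\<^sup>2)) * cis (2 * pi * b * x))
    = cis (- 2 * pi * a * b) * exp (- pi * b\<^sup>2 / t) / sqrt t"
proof -
  define s where "s = sqrt (2 * pi * t)"
  have s: "s > 0" "s\<^sup>2 = 2 * pi * t" using assms by (auto simp: s_def)
  define I where "I = (LINT x|lborel. complex_of_real (exp (- pi * t * (x + a)\<^sup>2)) * cis (2 * pi * b * x))"
  define u where "u = 2 * pi * b / s"
  have u: "u\<^sup>2 / 2 = pi * b\<^sup>2 / t"
    unfolding u_def power_divide s(2) using assms by (simp add: power2_eq_square field_simps)
  have "complex_of_real (exp (- pi * b\<^sup>2 / t)) = char std_normal_distribution u"
    by (simp add: char_std_normal_distribution u)
  also have "\<dots> = (LINT x|lborel. std_normal_density x *\<^sub>R iexp (u * x))"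
    unfolding char_def by (subst integral_density) (auto simp: normal_density_nonneg)
  also have "\<dots> = \<bar>s\<bar> *\<^sub>R (LINT x|lborel. std_normal_density (s * a + s * x) *\<^sub>R iexp (u * (s * a + s * x)))"
    using s by (intro lborel_integral_real_affine) auto
  also have "(\<lambda>x. std_normal_density (s * a + s * x) *\<^sub>R iexp (u * (s * a + s * x))) =
     (\<lambda>x. (cis (2 * pi * a * b) / sqrt (2 * pi)) *
        (complex_of_real (exp (- pi * t * (x + a)\<^sup>2)) * cis (2 * pi * b * x)))"
  proof
    fix x
    have 1: "(s * a + s * x)\<^sup>2 / 2 = pi * t * (x + a)\<^sup>2"
      using s(2) by (simp add: power_mult_distrib add.commute flip: distrib_left)
    have 2: "u * (s * a + s * x) = 2 * pi * a * b + 2 * pi * b * x"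
      using s(1) by (simp add: u_def field_simps)
    show "std_normal_density (s * a + s * x) *\<^sub>R iexp (u * (s * a + s * x)) =
      (cis (2 * pi * a * b) / sqrt (2 * pi)) *
        (complex_of_real (exp (- pi * t * (x + a)\<^sup>2)) * cis (2 * pi * b * x))"
      unfolding 2 cis_conv_exp[symmetric] cis_mult[symmetric] std_normal_density_def
      by (simp add: 1 scaleR_conv_of_real)
  qed
  also have "\<bar>s\<bar> *\<^sub>R (LINT x|lborel. (cis (2 * pi * a * b) / sqrt (2 * pi)) *
        (complex_of_real (exp (- pi * t * (x + a)\<^sup>2)) * cis (2 * pi * b * x))) = sqrt t * cis (2 * pi * a * b) * I"
    using s(1) by (simp add: I_def s_def real_sqrt_mult scaleR_conv_of_real)
  finally have "cis (- (2 * pi * a * b)) * exp (- pi * b\<^sup>2 / t) = 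
      (cis (- (2 * pi * a * b)) * cis (2 * pi * a * b)) * sqrt t * I"
    by (simp add: mult_ac)
  then show ?thesis using assms by (simp add: cis_mult I_def field_simps)
qed

lemma twisted_theta_inversion_real:
  fixes t a :: real
  assumes t: "t > 0"
  shows "(\<Sum>\<^sub>\<infinity>n::int. (- 1) powi n * complex_of_real (exp (- pi * t * (of_int n + a)\<^sup>2)))
    = (\<Sum>\<^sub>\<infinity>l::int. cis (pi * of_int (2 * l + 1) * a) * exp (- pi * (of_int (2 * l + 1))\<^sup>2 / (4 * t))) / sqrt t"
proof -
  \<comment> \<open>With the sign in \<open>cis (- pi * x)\<close> the coefficient at
    \<open>l\<close> is the Gaussian transform at frequency b = -(2l + 1)/2, and
    \<open>fourier_gaussian\<close> then produces the odd integer 2l + 1 in both the phase and the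
    exponent.\<close>
  define \<phi> where "\<phi> x = complex_of_real (exp (- pi * t * (x + a)\<^sup>2)) * cis (- pi * x)" for x
  define c where "c l = cis (pi * of_int (2 * l + 1) * a) * exp (- pi * (of_int (2 * l + 1))\<^sup>2 / (4 * t)) / sqrt t"
    for l :: int
  have "(\<Sum>\<^sub>\<infinity>n::int. \<phi> (of_int n)) = (\<Sum>\<^sub>\<infinity>l. c l)"
  proof (rule poisson_summation)
    show "continuous_on UNIV \<phi>" unfolding \<phi>_def by (intro continuous_intros)
    then have "\<phi> \<in> borel_measurable lborel" by (simp add: borel_measurable_continuous_onI)
    then show "integrable lborel \<phi>"
      by (rule Bochner_Integration.integrable_bound[OF integrable_gaussian[OF t, of a]])
        (auto simp: \<phi>_def norm_mult)
    show "norm (\<phi> (x + of_int n)) \<le> exp (1 / (4 * (pi * t)) + (1 + \<bar>a\<bar>)) * exp (- \<bar>of_int n\<bar>)"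
      if "\<bar>x\<bar> \<le> 1" for x and n :: int
      using gaussian_le_exp_neg_abs[of "pi * t" "x + a" "1 + \<bar>a\<bar>" n] t that
      by (simp add: \<phi>_def norm_mult algebra_simps)
    show "(\<lambda>n::int. exp (1 / (4 * (pi * t)) + (1 + \<bar>a\<bar>)) * exp (- \<bar>of_int n\<bar>)) summable_on UNIV"
      by (intro summable_on_cmult_right summable_on_exp_neg_abs)
    show "c l = (LINT x|lborel. \<phi> x * cis (- 2 * pi * of_int l * x))" for l
    proof -
      have "(\<lambda>x. \<phi> x * cis (- 2 * pi * of_int l * x)) =
         (\<lambda>x. complex_of_real (exp (- pi * t * (x + a)\<^sup>2)) * cis (2 * pi * (- of_int (2 * l + 1) / 2) * x))"
      proof
        fix x
        have *: "2 * pi * (- of_int (2 * l + 1) / 2) * x = - pi * x + - 2 * pi * of_int l * x"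
          by (simp add: field_simps)
        show "\<phi> x * cis (- 2 * pi * of_int l * x) =
            complex_of_real (exp (- pi * t * (x + a)\<^sup>2)) * cis (2 * pi * (- of_int (2 * l + 1) / 2) * x)"
          unfolding * cis_mult[symmetric] by (simp add: \<phi>_def)
      qed
      moreover have "- 2 * pi * a * (- m / 2) = pi * m * a" "- pi * (- m / 2)\<^sup>2 / t = - pi * m\<^sup>2 / (4 * t)"
        for m by (simp_all add: power_divide)
      ultimately show ?thesis
        unfolding c_def using fourier_gaussian[OF t, of a "- of_int (2 * l + 1) / 2"] by (simp only:)
    qed
    have "norm (c l) = 1 / sqrt t * exp (- (pi / t) * (of_int l + 1 / 2)\<^sup>2)" for l
    proof -
      have *: "(of_int (2 * l + 1))\<^sup>2 = 4 * (of_int l + 1 / 2 :: real)\<^sup>2"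
        by (simp add: power2_eq_square algebra_simps)
      show ?thesis
        unfolding c_def * norm_mult norm_divide norm_cis norm_of_real using t by simp
    qed
    then show "(\<lambda>l. norm (c l)) summable_on UNIV"
      using summable_on_cmult_right[OF summable_on_gaussian[of "pi / t" "1 / 2"], of "1 / sqrt t"] t
      by simp
  qed
  moreover have "\<phi> (of_int n) = (- 1) powi n * complex_of_real (exp (- pi * t * (of_int n + a)\<^sup>2))" for n
  proof -
    have "cis (- pi * of_int n) = cis (- pi) powi n" by (simp add: cis_power_int mult.commute)
    also have "cis (- pi) = - 1" by (simp add: complex_eq_iff)
    finally show ?thesis by (simp add: \<phi>_def)
  qed
  moreover have "(\<Sum>\<^sub>\<infinity>l. c l) = (\<Sum>\<^sub>\<infinity>l::int. cis (pi * of_int (2 * l + 1) * a)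
      * exp (- pi * (of_int (2 * l + 1))\<^sup>2 / (4 * t))) * (1 / sqrt t)"
    unfolding infsum_cmult_left'[symmetric] c_def by (simp only: times_divide_eq_right mult_1_right of_real_divide of_real_1)
  ultimately show ?thesis by (simp only: times_divide_eq_right mult_1_right of_real_divide of_real_1)
qed

section \<open>The theta functions on the upper half plane\<close>

lemma norm_qpow: "norm (qpow \<tau> r) = exp (- 2 * pi * r * Im \<tau>)"
  by (simp add: qpow_def)

lemma norm_theta_term: "norm ((- 1) powi n * qpow \<tau> r) = exp (- 2 * pi * r * Im \<tau>)"
  by (simp add: norm_mult norm_qpow norm_power_int)

lemma holomorphic_theta_g:
  assumes m: "m > 0"
  shows "theta_g j m holomorphic_on {\<tau>. Im \<tau> > 0}"
proof (rule holomorphic_onI)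
  fix z assume z: "z \<in> {\<tau>. Im \<tau> > 0}"
  \<comment> \<open>All points of the closed ball of radius \<delta> around \<open>z\<close> have
    imaginary part at least \<delta>, so one Gaussian series dominates there.\<close>
  define \<delta> where "\<delta> = Im z / 2"
  have \<delta>: "\<delta> > 0" using z by (simp add: \<delta>_def)
  define r where "r n = real m * (real_of_int n + real_of_int j / (2 * real m))\<^sup>2" for n
  have Im: "Im w \<ge> \<delta>" if "w \<in> cball z \<delta>" for w
    using that abs_Im_le_cmod[of "z - w"] by (simp add: dist_norm \<delta>_def)
  have u: "uniform_limit (cball z \<delta>) (\<lambda>X \<tau>. \<Sum>n\<in>X. (- 1) powi n * qpow \<tau> (r n)) (theta_g j m)
      (finite_subsets_at_top UNIV)"
    unfolding theta_g_def r_def[symmetric]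
  proof (rule Weierstrass_m_test_general)
    fix n w assume w: "w \<in> cball z \<delta>"
    have "2 * pi * r n * \<delta> \<le> 2 * pi * r n * Im w"
      using Im[OF w] by (intro mult_left_mono) (auto simp: r_def)
    then show "norm ((- 1) powi n * qpow w (r n))
        \<le> exp (- (2 * pi * \<delta> * real m) * (real_of_int n + real_of_int j / (2 * real m))\<^sup>2)"
      unfolding norm_theta_term by (simp add: r_def mult_ac)
  qed (use m \<delta> in \<open>intro summable_on_gaussian, auto\<close>)
  have "theta_g j m holomorphic_on ball z \<delta>"
    by (rule holomorphic_uniform_limit[OF _ u])
      (auto intro!: always_eventually continuous_intros holomorphic_intros simp: qpow_def)
  then show "theta_g j m field_differentiable at z within {\<tau>. Im \<tau> > 0}"
    using \<delta> by (meson centre_in_ball field_differentiable_at_within holomorphic_on_imp_differentiable_at open_ball)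
qed

section \<open>Splitting the odd integers by residue modulo 2m\<close>

lemma infsum_int_residues:
  fixes f :: "int \<Rightarrow> complex"
  assumes m: "m > 0" and f: "f summable_on UNIV"
  shows "(\<Sum>\<^sub>\<infinity>l. f l) = (\<Sum>i<m. \<Sum>\<^sub>\<infinity>n. f (int m * n + int i))"
proof -
  have bij: "bij_betw (\<lambda>(i, n). int m * n + int i) ({..<m} \<times> UNIV) UNIV"
  proof (rule bij_betwI[where g = "\<lambda>l. (nat (l mod int m), l div int m)"])
    show "(\<lambda>l. (nat (l mod int m), l div int m)) ((\<lambda>(i, n). int m * n + int i) x) = x"
      if "x \<in> {..<m} \<times> UNIV" for x
      using that by (auto simp: div_add1_eq)
  qed (use m in \<open>auto simp: nat_less_iff\<close>)
  have "(\<Sum>\<^sub>\<infinity>l. f l) = (\<Sum>\<^sub>\<infinity>(i, n)\<in>{..<m} \<times> UNIV. f (int m * n + int i))"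
    using infsum_reindex_bij_betw[OF bij, of f] by (simp add: case_prod_unfold)
  also have "\<dots> = (\<Sum>\<^sub>\<infinity>i\<in>{..<m}. \<Sum>\<^sub>\<infinity>n. f (int m * n + int i))"
    using summable_on_reindex_bij_betw[OF bij, of f] f
    by (intro infsum_Sigma'_banach[symmetric]) (simp add: case_prod_unfold)
  finally show ?thesis by simp
qed

text \<open>The inversion formula uses the oddness of \<open>j\<close> through this identity: for
  the signs within a residue class, and with \<open>n = 1\<close> for the reflection of the
  phases.\<close>

lemma cis_odd_pi:
  assumes "odd j"
  shows "cis (pi * of_int (n * j)) = (- 1) powi n"
proof -
  have "cis (pi * of_int (n * j)) = cis pi powi (n * j)"
    by (simp only: cis_power_int mult.commute)
  also have "\<dots> = (- 1) powi n"
    using assms by (simp add: power_int_minus_left)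
  finally show ?thesis .
qed

text \<open>Writing l = m n + i gives 2l + 1 = 2mn + (2i + 1). Then (2l + 1)^2/(4m) = m (n + (2i +
  1)/(2m))^2 is the exponent in g_{2i+1,m}, and the phase splits into a factor independent of n and
  exp(pi i n j) = (-1)^n, the sign in that series.\<close>

lemma infsum_odd_squares:
  assumes m: "m > 0" and "Im \<tau> > 0" and j: "odd j"
  shows "(\<Sum>\<^sub>\<infinity>l::int. cis (pi * of_int (2 * l + 1) * (of_int j / (2 * real m))) *
            qpow \<tau> ((of_int (2 * l + 1))\<^sup>2 / (4 * real m)))
    = (\<Sum>i<m. cis (pi * real (2 * i + 1) * of_int j / (2 * real m)) * theta_g (2 * int i + 1) m \<tau>)"
proof -
  define f where "f l = cis (pi * of_int (2 * l + 1) * (of_int j / (2 * real m))) *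
            qpow \<tau> ((of_int (2 * l + 1))\<^sup>2 / (4 * real m))" for l
  have sq: "- 2 * pi * ((of_int (2 * l + 1))\<^sup>2 / (4 * real m)) * Im \<tau>
      = - (2 * pi * Im \<tau> / real m) * (of_int l + 1 / 2)\<^sup>2" for l
  proof -
    have *: "(of_int (2 * l + 1))\<^sup>2 = 4 * (of_int l + 1 / 2 :: real)\<^sup>2"
      by (simp add: power2_eq_square algebra_simps)
    have "- 2 * pi * (4 * s / (4 * real m)) * Im \<tau> = - (2 * pi * Im \<tau> / real m) * s" for s
      by simp
    then show ?thesis unfolding * .
  qed
  have norm_f: "norm (f l) = exp (- (2 * pi * Im \<tau> / real m) * (of_int l + 1 / 2)\<^sup>2)" for l
    unfolding f_def norm_mult norm_qpow norm_cis sq by simp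
  have "(\<lambda>l. norm (f l)) summable_on UNIV"
    unfolding norm_f using assms by (intro summable_on_gaussian) simp
  then have "f summable_on UNIV" by (rule abs_summable_summable)
  then have sum_f: "(\<Sum>\<^sub>\<infinity>l. f l) = (\<Sum>i<m. \<Sum>\<^sub>\<infinity>n. f (int m * n + int i))"
    by (rule infsum_int_residues[OF m])
  have f_eq: "f (int m * n + int i) = cis (pi * real (2 * i + 1) * of_int j / (2 * real m)) *
     ((- 1) powi n * qpow \<tau> (real m * (real_of_int n + real_of_int (2 * int i + 1) / (2 * real m))\<^sup>2))" for i n
  proof -
    have 1: "pi * of_int (2 * (int m * n + int i) + 1) * (of_int j / (2 * real m))
      = pi * real (2 * i + 1) * of_int j / (2 * real m) + pi * of_int (n * j)"
      using m by (simp add: field_simps)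
    have 2: "(of_int (2 * (int m * n + int i) + 1))\<^sup>2 / (4 * real m)
      = real m * (real_of_int n + real_of_int (2 * int i + 1) / (2 * real m))\<^sup>2"
      using m by (simp add: field_simps power2_eq_square)
    show ?thesis unfolding f_def 1 2 cis_mult[symmetric] cis_odd_pi[OF j] by simp
  qed
  show ?thesis
    using sum_f unfolding f_eq infsum_cmult_right' theta_g_def[symmetric] unfolding f_def .
qed

section \<open>Analytic continuation from the imaginary axis\<close>

lemma upper_half_plane_identity:
  assumes hol: "f holomorphic_on {\<tau>. Im \<tau> > 0}"
    and zero: "\<And>y. y > 0 \<Longrightarrow> f (\<i> * complex_of_real y) = 0" and \<tau>: "Im \<tau> > 0"
  shows "f \<tau> = 0"
proof (rule analytic_continuation[OF hol])
  define U where "U = (\<lambda>y. \<i> * complex_of_real y) ` {0<..}"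
  show "U \<subseteq> {\<tau>. Im \<tau> > 0}" by (auto simp: U_def)
  show "\<i> islimpt U"
    unfolding islimpt_approachable
  proof (intro allI impI)
    fix e :: real assume "e > 0"
    define z where "z = \<i> * complex_of_real (1 + e / 2)"
    have "z - \<i> = \<i> * complex_of_real (e / 2)"
      by (simp add: z_def distrib_left)
    then have "dist z \<i> = e / 2"
      unfolding dist_norm using \<open>e > 0\<close> by (simp only: norm_mult norm_of_real) simp
    moreover have "z \<in> U"
      unfolding U_def z_def using \<open>e > 0\<close> by (intro imageI) simp
    ultimately show "\<exists>x'\<in>U. x' \<noteq> \<i> \<and> dist x' \<i> < e"
      using \<open>e > 0\<close> by (intro bexI[of _ z]) auto
  qed
  show "f w = 0" if "w \<in> U" for w using that zero by (auto simp: U_def)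
qed (use \<tau> in \<open>auto simp: open_halfspace_Im_gt convex_connected convex_halfspace_Im_gt\<close>)

lemma qpow_imaginary: "qpow (\<i> * complex_of_real y) r = complex_of_real (exp (- 2 * pi * r * y))"
proof -
  have "2 * complex_of_real pi * \<i> * complex_of_real r * (\<i> * of_real y) = complex_of_real (- 2 * pi * r * y)"
    by (simp add: complex_eq_iff)
  then show ?thesis unfolding qpow_def by (simp only: exp_of_real)
qed

lemma theta_g_inversion_imaginary:
  assumes m: "m > 0" and y: "y > 0" and j: "odd j"
  defines "w \<equiv> \<i> * complex_of_real y"
  shows "theta_g j m (- 1 / (4 * w)) = csqrt (- 2 * \<i> * w) / complex_of_real (sqrt (real m)) *
    (\<Sum>i<m. cis (pi * real (2 * i + 1) * of_int j / (2 * real m)) * theta_g (2 * int i + 1) m w)"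
proof -
  \<comment> \<open>This \<open>t\<close> matches exp(-pi t x) with q^(m x) at the point -1/(4w);
    then exp(-pi s^2/(4t)) is q^(s^2/(4m)) at \<open>w\<close>.\<close>
  define t where "t = real m / (2 * y)"
  define a where "a = of_int j / (2 * real m)"
  have t: "t > 0" using y m by (simp add: t_def)
  have w1: "- 1 / (4 * w) = \<i> * of_real (1 / (4 * y))"
    using y by (simp add: w_def divide_simps)
  have e1: "- 2 * pi * (real m * x) * (1 / (4 * y)) = - pi * t * x" for x
    using y by (simp add: t_def field_simps)
  have e2: "- pi * x / (4 * t) = - 2 * pi * (x / (4 * real m)) * y" for x
    using y m by (simp add: t_def field_simps)
  have "theta_g j m (- 1 / (4 * w)) = (\<Sum>\<^sub>\<infinity>n::int. (- 1) powi n * complex_of_real (exp (- pi * t * (of_int n + a)\<^sup>2)))"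
    unfolding theta_g_def w1 qpow_imaginary e1 a_def ..
  also have "\<dots> = (\<Sum>\<^sub>\<infinity>l::int. cis (pi * of_int (2 * l + 1) * a) * exp (- pi * (of_int (2 * l + 1))\<^sup>2 / (4 * t))) / sqrt t"
    by (rule twisted_theta_inversion_real[OF t])
  also have "(\<Sum>\<^sub>\<infinity>l::int. cis (pi * of_int (2 * l + 1) * a) * exp (- pi * (of_int (2 * l + 1))\<^sup>2 / (4 * t)))
      = (\<Sum>i<m. cis (pi * real (2 * i + 1) * of_int j / (2 * real m)) * theta_g (2 * int i + 1) m w)"
    unfolding e2 qpow_imaginary[symmetric] a_def w_def[symmetric]
    by (rule infsum_odd_squares[OF m _ j]) (simp add: y w_def)
  finally have theta: "theta_g j m (- 1 / (4 * w)) =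
      (\<Sum>i<m. cis (pi * real (2 * i + 1) * of_int j / (2 * real m)) * theta_g (2 * int i + 1) m w) / sqrt t" .
  have "- 2 * \<i> * w = complex_of_real (2 * y)" by (simp add: w_def complex_eq_iff)
  then have "csqrt (- 2 * \<i> * w) = complex_of_real (sqrt (2 * y))"
    using y csqrt_of_real_nonneg[of "2 * y"] by (simp only:) simp
  then have "csqrt (- 2 * \<i> * w) / complex_of_real (sqrt (real m)) = 1 / complex_of_real (sqrt t)"
    using y m by (simp add: t_def real_sqrt_divide)
  then show ?thesis unfolding theta by simp
qed

lemma Im_uminus_inverse_pos:
  assumes "Im w > 0"
  shows "Im (- 1 / (4 * w)) > 0"
proof -
  have "(Re w)\<^sup>2 + (Im w)\<^sup>2 > 0" using assms by (simp add: add_nonneg_pos)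
  moreover have "- 1 / (4 * w) = (- 1 / 4) *\<^sub>R inverse w"
    using assms by (cases "w = 0") (auto simp: scaleR_conv_of_real field_simps)
  ultimately show ?thesis using assms by simp
qed

lemma theta_g_inversion_cis:
  assumes m: "m > 0" and \<tau>: "Im \<tau> > 0" and j: "odd j"
  shows "theta_g j m (- 1 / (4 * \<tau>)) = csqrt (- 2 * \<i> * \<tau>) / complex_of_real (sqrt (real m)) *
    (\<Sum>i<m. cis (pi * real (2 * i + 1) * of_int j / (2 * real m)) * theta_g (2 * int i + 1) m \<tau>)"
proof -
  let ?H = "{\<tau>. Im \<tau> > 0}"
  define R where "R \<tau> = csqrt (- 2 * \<i> * \<tau>) / complex_of_real (sqrt (real m)) *
    (\<Sum>i<m. cis (pi * real (2 * i + 1) * of_int j / (2 * real m)) * theta_g (2 * int i + 1) m \<tau>)" for \<tau>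
  have holL: "(\<lambda>w. theta_g j m (- 1 / (4 * w))) holomorphic_on ?H"
  proof -
    have "(\<lambda>w. - 1 / (4 * w)) holomorphic_on ?H" by (auto intro!: holomorphic_intros)
    moreover have "(\<lambda>w. - 1 / (4 * w)) ` ?H \<subseteq> ?H" using Im_uminus_inverse_pos by blast
    ultimately show ?thesis
      using holomorphic_on_compose_gen[OF _ holomorphic_theta_g[OF m, of j]] by (auto simp: o_def)
  qed
  have holR: "R holomorphic_on ?H"
  proof -
    \<comment> \<open>On the half plane \<open>- 2 * \<i> * w\<close> has real part 2 Im w > 0 and
      so avoids the branch cut of \<open>csqrt\<close>.\<close>
    have "(\<lambda>w. csqrt (- 2 * \<i> * w)) holomorphic_on ?H"
      by (rule holomorphic_on_csqrt') (auto intro!: holomorphic_intros simp: complex_nonpos_Reals_iff)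
    then show ?thesis
      unfolding R_def using m
      by (intro holomorphic_on_mult holomorphic_on_divide holomorphic_on_sum holomorphic_on_const
          holomorphic_theta_g) auto
  qed
  have "theta_g j m (- 1 / (4 * \<tau>)) - R \<tau> = 0"
  proof (rule upper_half_plane_identity[where f = "\<lambda>w. theta_g j m (- 1 / (4 * w)) - R w"])
    show "theta_g j m (- 1 / (4 * (\<i> * complex_of_real y))) - R (\<i> * complex_of_real y) = 0" if "y > 0" for y
      unfolding R_def theta_g_inversion_imaginary[OF m that j] by simp
  qed (intro holomorphic_on_diff holL holR \<tau>)+
  then show ?thesis by (simp add: R_def)
qed

section \<open>Reflection and folding to half of the residues\<close>

lemma theta_g_reflect: "theta_g (2 * int m - r) m \<tau> = - theta_g r m \<tau>" if "m > 0"
proof -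
  have "theta_g (2 * int m - r) m \<tau> = (\<Sum>\<^sub>\<infinity>n. - ((- 1) powi n * qpow \<tau> (real m * (real_of_int n + real_of_int r / (2 * real m))\<^sup>2)))"
    unfolding theta_g_def
  \<comment> \<open>Since n + (2m - r)/(2m) = -((-n - 1) + r/(2m)), the involution n -> -n - 1
    preserves the squares; it changes the parity of n, whence the minus sign.\<close>
  proof (rule infsum_reindex_bij_witness[of _ "\<lambda>n. - n - 1" "\<lambda>n. - n - 1"])
    fix n :: int
    have "real_of_int (- n - 1) + real_of_int r / (2 * real m) = - (real_of_int n + real_of_int (2 * int m - r) / (2 * real m))"
      using that by (simp add: field_simps)
    then have "(real_of_int (- n - 1) + real_of_int r / (2 * real m))\<^sup>2 = (real_of_int n + real_of_int (2 * int m - r) / (2 * real m))\<^sup>2"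
      by (simp only: power2_minus)
    moreover have "- ((- 1 :: complex) powi (- n - 1)) = (- 1) powi n"
      by (simp add: power_int_minus_left)
    ultimately show "- ((- 1) powi (- n - 1) * qpow \<tau> (real m * (real_of_int (- n - 1) + real_of_int r / (2 * real m))\<^sup>2))
      = (- 1) powi n * qpow \<tau> (real m * (real_of_int n + real_of_int (2 * int m - r) / (2 * real m))\<^sup>2)"
      by (metis mult_minus_left)
  qed auto
  then show ?thesis by (simp add: theta_g_def infsum_uminus)
qed

text \<open>The reflection i -> m - 1 - i exchanges the lower and the upper half; for odd
  \<open>m\<close> it fixes \<open>m div 2\<close>, whose term must vanish.\<close>

lemma sum_reflect_half:
  fixes h :: "nat \<Rightarrow> 'a::comm_ring_1"
  assumes refl: "\<And>i. i < m \<Longrightarrow> h (m - 1 - i) = h i" and mid: "odd m \<Longrightarrow> h (m div 2) = 0"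
  shows "(\<Sum>i<m. h i) = 2 * (\<Sum>i<m div 2. h i)"
proof -
  have "(\<Sum>i\<in>{m - m div 2..<m}. h i) = (\<Sum>i<m div 2. h i)"
    by (rule sum.reindex_bij_witness[of _ "\<lambda>i. m - 1 - i" "\<lambda>i. m - 1 - i"]) (use refl in auto)
  moreover have "(\<Sum>i<m. h i) = (\<Sum>i<m - m div 2. h i) + (\<Sum>i\<in>{m - m div 2..<m}. h i)"
    by (subst sum.union_disjoint[symmetric]) (auto intro: sum.cong)
  moreover have "(\<Sum>i<m - m div 2. h i) = (\<Sum>i<m div 2. h i)"
  proof (cases "even m")
    case True
    then have "m - m div 2 = m div 2" by presburger
    then show ?thesis by simp
  next
    case False
    then have "m - m div 2 = Suc (m div 2)" by presburger
    then show ?thesis using mid False by simp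
  qed
  ultimately show ?thesis by simp
qed

text \<open>In terms of r = 2i + 1 the map i -> m - 1 - i is r -> 2m - r. It negates the theta
  function and, as \<open>j\<close> is odd, sends \<open>cis (x i)\<close> to
  \<open>- cis (- x i)\<close>. The signs cancel, so averaging the sum with its reflection replaces
  \<open>cis\<close> by \<open>cos\<close>; folding the symmetric sum gives the factor 2.\<close>

lemma theta_g_inversion:
  assumes m: "m > 0" and \<tau>: "Im \<tau> > 0" and j: "odd j"
  shows "theta_g j m (- 1 / (4 * \<tau>)) = 2 * csqrt (- 2 * \<i> * \<tau>) / complex_of_real (sqrt (real m)) *
    (\<Sum>i<m div 2. complex_of_real (cos (of_int j * real (2 * i + 1) * pi / (2 * real m))) * theta_g (2 * int i + 1) m \<tau>)"
proof -
  define x where "x i = pi * real (2 * i + 1) * of_int j / (2 * real m)" for i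
  define \<theta> where "\<theta> i = theta_g (2 * int i + 1) m \<tau>" for i
  have \<theta>: "\<theta> (m - 1 - i) = - \<theta> i" if "i < m" for i
  proof -
    have "2 * int (m - 1 - i) + 1 = 2 * int m - (2 * int i + 1)" using that by simp
    then show ?thesis unfolding \<theta>_def by (simp only: theta_g_reflect[OF m])
  qed
  have x: "cis (x (m - 1 - i)) = - cis (- x i)" if "i < m" for i
  proof -
    have "real (2 * (m - 1 - i) + 1) = 2 * real m - real (2 * i + 1)" using that by (simp add: of_nat_diff)
    then have "x (m - 1 - i) = pi * of_int (1 * j) + - x i"
      unfolding x_def using m by (simp only:) (simp add: field_simps)
    then have "cis (x (m - 1 - i)) = cis (pi * of_int (1 * j)) * cis (- x i)" by (simp only: cis_mult)
    then show ?thesis unfolding cis_odd_pi[OF j] by simp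
  qed
  define h where "h i = complex_of_real (cos (x i)) * \<theta> i" for i
  have "(\<Sum>i<m. cis (x i) * \<theta> i) = (\<Sum>i<m. cis (x (m - 1 - i)) * \<theta> (m - 1 - i))"
    by (rule sum.reindex_bij_witness[of _ "\<lambda>i. m - 1 - i" "\<lambda>i. m - 1 - i"]) auto
  also have "\<dots> = (\<Sum>i<m. cis (- x i) * \<theta> i)"
    by (intro sum.cong refl) (simp only: lessThan_iff x \<theta> minus_mult_minus)
  finally have "2 * (\<Sum>i<m. cis (x i) * \<theta> i) = (\<Sum>i<m. (cis (x i) + cis (- x i)) * \<theta> i)"
    by (simp add: sum.distrib distrib_right)
  also have "\<dots> = (\<Sum>i<m. 2 * h i)"
    by (intro sum.cong refl) (simp add: h_def complex_eq_iff)
  finally have "(\<Sum>i<m. cis (x i) * \<theta> i) = (\<Sum>i<m. h i)"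
    by (simp add: sum_distrib_left[symmetric])
  also have "\<dots> = 2 * (\<Sum>i<m div 2. h i)"
  proof (rule sum_reflect_half)
    show "h (m - 1 - i) = h i" if "i < m" for i
      using arg_cong[OF x[OF that], of Re] \<theta>[OF that] by (simp add: h_def)
    \<comment> \<open>The middle index belongs to r = m and is fixed by the reflection, so its theta
      function equals its own negative.\<close>
    assume "odd m"
    then have "m - 1 - m div 2 = m div 2" "m div 2 < m" by presburger+
    then show "h (m div 2) = 0" using \<theta>[of "m div 2"] by (simp add: h_def)
  qed
  finally have *: "(\<Sum>i<m. cis (x i) * \<theta> i) = 2 * (\<Sum>i<m div 2. h i)" .
  have h: "h i = complex_of_real (cos (of_int j * real (2 * i + 1) * pi / (2 * real m))) * theta_g (2 * int i + 1) m \<tau>" for i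
    by (simp add: h_def x_def \<theta>_def mult_ac)
  show ?thesis
    unfolding theta_g_inversion_cis[OF m \<tau> j] x_def[symmetric] \<theta>_def[symmetric] *
    unfolding h \<theta>_def by simp
qed

section \<open>Translation by 1\<close>

lemma theta_g_shift:
  assumes "m > 0"
  shows "theta_g j m (\<tau> + 1) = exp (of_int (j\<^sup>2) / (2 * of_nat m) * complex_of_real pi * \<i>) * theta_g j m \<tau>"
proof -
  have "qpow (\<tau> + 1) (real m * (real_of_int n + real_of_int j / (2 * real m))\<^sup>2) =
     exp (of_int (j\<^sup>2) / (2 * of_nat m) * complex_of_real pi * \<i>) *
      qpow \<tau> (real m * (real_of_int n + real_of_int j / (2 * real m))\<^sup>2)" for n
  proof -
    define r where "r = real m * (real_of_int n + real_of_int j / (2 * real m))\<^sup>2"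
    \<comment> \<open>Expanding the square leaves an integer plus j^2/(4m). The integer disappears
      in exp(2 pi i r), so the factor is the same for all n.\<close>
    have "r = of_int (int m * n\<^sup>2 + n * j) + of_int (j\<^sup>2) / (4 * real m)"
      unfolding r_def using assms by (simp add: field_simps power2_eq_square)
    then have "2 * r = 2 * of_int (int m * n\<^sup>2 + n * j) + of_int (j\<^sup>2) / (2 * real m)"
      by (simp add: field_simps)
    from arg_cong[OF this, of complex_of_real]
    have "2 * complex_of_real r = 2 * of_int (int m * n\<^sup>2 + n * j) + of_int (j\<^sup>2) / (2 * of_nat m)"
      by simp
    moreover have "qpow 1 r = exp ((2 * complex_of_real r) * complex_of_real pi * \<i>)"
      by (simp add: qpow_def mult_ac)
    ultimately have "qpow 1 r = exp (2 * of_int (int m * n\<^sup>2 + n * j) * complex_of_real pi * \<i>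
         + of_int (j\<^sup>2) / (2 * of_nat m) * complex_of_real pi * \<i>)"
      by (simp only: distrib_right)
    also have "\<dots> = exp (of_int (j\<^sup>2) / (2 * of_nat m) * complex_of_real pi * \<i>)"
      unfolding exp_add using exp_integer_2pi[of "of_int (int m * n\<^sup>2 + n * j)"] by simp
    also have "qpow (\<tau> + 1) r = qpow 1 r * qpow \<tau> r"
      by (simp add: qpow_def distrib_left exp_add)
    ultimately show ?thesis unfolding r_def by simp
  qed
  then show ?thesis
    unfolding theta_g_def infsum_cmult_right'[symmetric] by (simp only: mult.left_commute)
qed

section \<open>The vector-valued transformation\<close>

text \<open>This reconciles the dimension of \<open>G1\<close> and \<open>Lambda_mat\<close>, given
  through \<open>t_max\<close>, with that of \<open>A_mat\<close>: the largest odd number below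
  \<open>k\<close> is \<open>2 * (k div 2) - 1\<close>.\<close>

lemma half_t_max: "(t_max k + 1) div 2 = k div 2" if "k \<ge> 2"
proof -
  have "t_max k = 2 * (k div 2) - 1"
    unfolding t_max_def
  proof (rule Max_eqI)
    show "finite {t. odd t \<and> t < k}" by (rule finite_subset[of _ "{..<k}"]) auto
    show "t \<le> 2 * (k div 2) - 1" if "t \<in> {t. odd t \<and> t < k}" for t
      using that unfolding mem_Collect_eq by presburger
    have "odd (2 * (k div 2) - 1)" using that by (cases "k div 2") auto
    then show "2 * (k div 2) - 1 \<in> {t. odd t \<and> t < k}" using that by auto
  qed
  then show ?thesis using that by simp
qed

lemma G1_carrier: "G1 k \<tau> \<in> carrier_vec (k div 2)" if "k \<ge> 2"
  using half_t_max[OF that] by (simp add: G1_def)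

text \<open>The value of \<open>mat_inverse\<close> is reached through its specification: as the
  diagonal matrix D is a unit, some \<open>B\<close> with D B = 1 is returned, and B = E (D B) = E
  for the inverse diagonal matrix E.\<close>

lemma mat_inv_mat_diag:
  assumes "\<And>i. f i \<noteq> 0"
  shows "mat_inv (mat_diag n f) = mat_diag n (\<lambda>i. inverse (f i))"
proof -
  let ?D = "mat_diag n f" and ?E = "mat_diag n (\<lambda>i. inverse (f i))"
  have DE: "?D * ?E = 1\<^sub>m n" "?E * ?D = 1\<^sub>m n" using assms by simp_all
  have D: "?D \<in> carrier_mat n n" by simp
  have "?D \<in> Units (ring_mat TYPE(complex) n ())"
    unfolding Units_def ring_mat_def using DE by (auto intro!: bexI[of _ ?E] simp del: mat_diag_diag)
  then obtain B where B: "mat_inverse ?D = Some B"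
    using mat_inverse(1)[OF D, where b = "()"] by (cases "mat_inverse ?D") auto
  have B': "?D * B = 1\<^sub>m n" "B \<in> carrier_mat n n" using mat_inverse(2)[OF D B] by auto
  have "B = 1\<^sub>m n * B" using B' by simp
  also have "\<dots> = ?E * (?D * B)" unfolding DE(2)[symmetric] using B' D by (intro assoc_mult_mat[of _ n n _ n _ n]) simp_all
  also have "\<dots> = ?E" using B' right_mult_one_mat[of ?E n n] by simp
  finally show ?thesis using B by (simp add: mat_inv_def)
qed

text \<open>Both arguments lie in (-pi/2, pi/2), so their sum stays in (-pi, pi) and the principal
  roots multiply without a sign.\<close>

lemma csqrt_mult_Re_pos:
  assumes "Re z > 0" "Re w > 0"
  shows "csqrt z * csqrt w = csqrt (z * w)"
  using assms Arg_Re_pos[of z] Arg_Re_pos[of w] by (intro csqrt_mult[symmetric]) auto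

lemma mat_diag_mult_vec:
  assumes "v \<in> carrier_vec n"
  shows "mat_diag n f *\<^sub>v v = Matrix.vec n (\<lambda>i. f i * vec_index v i)"
proof (rule eq_vecI)
  fix i assume "i < dim_vec (Matrix.vec n (\<lambda>i. f i * vec_index v i))"
  then have i: "i < n" by simp
  have "vec_index (mat_diag n f *\<^sub>v v) i = (\<Sum>j<n. (if i = j then f j else 0) * vec_index v j)"
    using i assms by (auto simp: mat_diag_def scalar_prod_def lessThan_atLeast0)
  also have "\<dots> = (\<Sum>j<n. if i = j then f j * vec_index v j else 0)"
    by (intro sum.cong) auto
  also have "\<dots> = f i * vec_index v i" using i by simp
  finally show "vec_index (mat_diag n f *\<^sub>v v) i = vec_index (Matrix.vec n (\<lambda>i. f i * vec_index v i)) i"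
    using i by simp
qed (simp add: mat_diag_def)

lemma G1_shift:
  assumes "k \<ge> 2"
  shows "G1 k (\<tau> + 1) = Lambda_mat k *\<^sub>v G1 k \<tau>"
proof -
  have "theta_g (2 * int i + 1) k (\<tau> + 1) =
      exp (of_nat ((2 * i + 1)\<^sup>2) / (2 * of_nat k) * complex_of_real pi * \<i>) * theta_g (2 * int i + 1) k \<tau>" for i
  proof -
    have "(2 * int i + 1)\<^sup>2 = int ((2 * i + 1)\<^sup>2)" by simp
    then show ?thesis
      using theta_g_shift[of k "2 * int i + 1" \<tau>] assms by (simp only: of_int_of_nat_eq)
  qed
  then show ?thesis
    unfolding Lambda_mat_def G1_def
    by (subst mat_diag_mult_vec) (auto intro!: eq_vecI)
qed

lemma G1_inversion:
  assumes k: "k \<ge> 2" and \<tau>: "Im \<tau> > 0"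
  shows "G1 k (- 1 / (4 * \<tau>)) =
    (2 * csqrt (- 2 * \<i> * \<tau>) / complex_of_real (sqrt (real k))) \<cdot>\<^sub>v (A_mat k *\<^sub>v G1 k \<tau>)"
proof (rule eq_vecI)
  fix i assume "i < dim_vec ((2 * csqrt (- 2 * \<i> * \<tau>) / complex_of_real (sqrt (real k))) \<cdot>\<^sub>v (A_mat k *\<^sub>v G1 k \<tau>))"
  then have i: "i < k div 2" by (simp add: A_mat_def)
  have A: "vec_index (A_mat k *\<^sub>v G1 k \<tau>) i = (\<Sum>j<k div 2.
     complex_of_real (cos (real (2 * i + 1) * real (2 * j + 1) * pi / (2 * real k))) * theta_g (2 * int j + 1) k \<tau>)"
    unfolding A_mat_def G1_def half_t_max[OF k] scalar_prod_def using i
    by (simp add: scalar_prod_def lessThan_atLeast0)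
  have cast: "real_of_int (2 * int i + 1) = real (2 * i + 1)" by simp
  have "vec_index (G1 k (- 1 / (4 * \<tau>))) i = theta_g (2 * int i + 1) k (- 1 / (4 * \<tau>))"
    unfolding G1_def half_t_max[OF k] using i by simp
  also have "\<dots> = 2 * csqrt (- 2 * \<i> * \<tau>) / complex_of_real (sqrt (real k)) * vec_index (A_mat k *\<^sub>v G1 k \<tau>) i"
    unfolding A cast[symmetric] using k by (intro theta_g_inversion \<tau>) auto
  also have "\<dots> = vec_index ((2 * csqrt (- 2 * \<i> * \<tau>) / complex_of_real (sqrt (real k))) \<cdot>\<^sub>v (A_mat k *\<^sub>v G1 k \<tau>)) i"
    using i by (subst index_smult_vec) (simp_all add: A_mat_def)
  finally show "vec_index (G1 k (- 1 / (4 * \<tau>))) i =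
    vec_index ((2 * csqrt (- 2 * \<i> * \<tau>) / complex_of_real (sqrt (real k))) \<cdot>\<^sub>v (A_mat k *\<^sub>v G1 k \<tau>)) i" .
qed (use G1_carrier[OF k] in \<open>auto simp: A_mat_def\<close>)

theorem theorem1p3:
  fixes k :: nat and \<tau> :: complex
  assumes "k \<ge> 2" and "Im \<tau> > 0"
  shows "G1 k (\<tau> + 1) = Lambda_mat k *\<^sub>v G1 k \<tau>
    \<and> G1 k (- 1 / (4 * \<tau>)) =
        (2 * csqrt (- 2 * \<i> * \<tau>) / complex_of_real (sqrt (real k))) \<cdot>\<^sub>v (A_mat k *\<^sub>v G1 k \<tau>)
    \<and> G1 k (\<tau> / (4 * \<tau> + 1)) =
        (4 * csqrt (4 * \<tau> + 1) / of_nat k) \<cdot>\<^sub>v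
          ((A_mat k * mat_inv (Lambda_mat k) * A_mat k) *\<^sub>v G1 k \<tau>)"
proof (intro conjI)
  let ?n = "k div 2" and ?A = "A_mat k" and ?L = "Lambda_mat k" and ?G = "G1 k \<tau>"
  show "G1 k (\<tau> + 1) = ?L *\<^sub>v ?G" by (rule G1_shift[OF assms(1)])
  show S: "G1 k (- 1 / (4 * \<tau>)) =
      (2 * csqrt (- 2 * \<i> * \<tau>) / complex_of_real (sqrt (real k))) \<cdot>\<^sub>v (?A *\<^sub>v ?G)"
    by (rule G1_inversion[OF assms])
  define M where "M = mat_inv ?L"
  define \<sigma> where "\<sigma> = - 1 / (4 * \<tau>) - 1"
  have \<tau>0: "\<tau> \<noteq> 0" using assms by auto
  have \<sigma>: "Im \<sigma> > 0" unfolding \<sigma>_def using Im_uminus_inverse_pos[OF assms(2)] by simp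
  have \<sigma>\<tau>: "4 * (\<sigma> * \<tau>) = - (4 * \<tau> + 1)" using \<tau>0 by (simp add: \<sigma>_def field_simps)
  have "(- 2 * \<i> * \<sigma>) * (- 2 * \<i> * \<tau>) = - (4 * (\<sigma> * \<tau>))" by (simp add: algebra_simps)
  then have prod: "(- 2 * \<i> * \<sigma>) * (- 2 * \<i> * \<tau>) = 4 * \<tau> + 1" unfolding \<sigma>\<tau> by simp
  have "\<sigma> \<noteq> 0" using \<sigma> by auto
  moreover have "4 * \<tau> + 1 \<noteq> 0" using assms(2) by (auto simp: complex_eq_iff)
  ultimately have \<sigma>_inv: "- 1 / (4 * \<sigma>) = \<tau> / (4 * \<tau> + 1)"
    using \<sigma>\<tau> by (subst frac_eq_eq) (auto simp: mult_ac)
  define c where "c = 2 * csqrt (- 2 * \<i> * \<tau>) / complex_of_real (sqrt (real k))"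
  define d where "d = 2 * csqrt (- 2 * \<i> * \<sigma>) / complex_of_real (sqrt (real k))"
  have cd: "d * c = 4 * csqrt (4 * \<tau> + 1) / of_nat k"
  proof -
    \<comment> \<open>Each of the two inversions contributes one root; the radicands have real parts
      2 Im \<sigma> and 2 Im \<tau>, both positive.\<close>
    have "csqrt (- 2 * \<i> * \<sigma>) * csqrt (- 2 * \<i> * \<tau>) = csqrt (4 * \<tau> + 1)"
      unfolding prod[symmetric] using \<sigma> assms by (intro csqrt_mult_Re_pos) auto
    moreover have "complex_of_real (sqrt (real k)) * complex_of_real (sqrt (real k)) = of_nat k"
      by (simp flip: of_real_mult)
    ultimately show ?thesis by (simp add: c_def d_def)
  qed
  have L: "?L = mat_diag ?n (\<lambda>i. exp (of_nat ((2 * i + 1)\<^sup>2) / (2 * of_nat k) * complex_of_real pi * \<i>))"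
    by (simp only: Lambda_mat_def half_t_max[OF assms(1)])
  have M: "M = mat_diag ?n (\<lambda>i. inverse (exp (of_nat ((2 * i + 1)\<^sup>2) / (2 * of_nat k) * complex_of_real pi * \<i>)))"
    unfolding M_def L by (rule mat_inv_mat_diag) simp
  have MinvL: "M * ?L = 1\<^sub>m ?n" unfolding M L by simp
  have [simp]: "?A \<in> carrier_mat ?n ?n" "M \<in> carrier_mat ?n ?n" "?L \<in> carrier_mat ?n ?n"
    by (simp_all add: A_mat_def M L)
  have [simp]: "G1 k w \<in> carrier_vec ?n" for w by (rule G1_carrier[OF assms(1)])
  \<comment> \<open>As \<sigma> + 1 = -1/(4 \<tau>), the translation law at \<sigma> is undone by
    \<open>M\<close>, which recovers \<open>G1 k \<sigma>\<close> from the vector obtained by the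
    first inversion.\<close>
  have "M *\<^sub>v G1 k (- 1 / (4 * \<tau>)) = M *\<^sub>v (?L *\<^sub>v G1 k \<sigma>)"
    using G1_shift[OF assms(1), of \<sigma>] by (simp add: \<sigma>_def)
  also have "\<dots> = (M * ?L) *\<^sub>v G1 k \<sigma>" by (rule assoc_mult_mat_vec[of _ ?n ?n _ ?n, symmetric]) simp_all
  also have "\<dots> = G1 k \<sigma>" unfolding MinvL by simp
  finally have G\<sigma>: "G1 k \<sigma> = M *\<^sub>v (c \<cdot>\<^sub>v (?A *\<^sub>v ?G))" using S by (simp add: c_def)
  \<comment> \<open>The second inversion, now at \<sigma>, contributes \<open>d\<close> and the left
    factor \<open>A_mat k\<close>.\<close>
  have "G1 k (\<tau> / (4 * \<tau> + 1)) = d \<cdot>\<^sub>v (?A *\<^sub>v G1 k \<sigma>)"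
    using G1_inversion[OF assms(1) \<sigma>] by (simp only: \<sigma>_inv d_def)
  also have "?A *\<^sub>v G1 k \<sigma> = c \<cdot>\<^sub>v (?A *\<^sub>v (M *\<^sub>v (?A *\<^sub>v ?G)))"
    unfolding G\<sigma> by (subst mult_mat_vec[of _ ?n ?n]; (subst mult_mat_vec[of _ ?n ?n])?)
      (auto intro!: mult_mat_vec_carrier[of _ ?n ?n])
  also have "?A *\<^sub>v (M *\<^sub>v (?A *\<^sub>v ?G)) = (?A * M * ?A) *\<^sub>v ?G"
  proof -
    have "(?A * M * ?A) *\<^sub>v ?G = (?A * M) *\<^sub>v (?A *\<^sub>v ?G)"
      by (rule assoc_mult_mat_vec[of _ ?n ?n _ ?n]) (auto intro: mult_carrier_mat[of _ ?n ?n])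
    also have "\<dots> = ?A *\<^sub>v (M *\<^sub>v (?A *\<^sub>v ?G))"
      by (rule assoc_mult_mat_vec[of _ ?n ?n _ ?n]) (auto intro: mult_mat_vec_carrier[of _ ?n ?n])
    finally show ?thesis by (rule sym)
  qed
  finally show "G1 k (\<tau> / (4 * \<tau> + 1)) = (4 * csqrt (4 * \<tau> + 1) / of_nat k) \<cdot>\<^sub>v
      ((?A * mat_inv ?L * ?A) *\<^sub>v ?G)"
    by (simp add: smult_smult_assoc cd M_def)
qed

end
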